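(* Let $A\in\mathbb{R}^{d\times d}$, let $S:\mathbb{R}^d\to\mathbb{R}^{d\times d}$ be a matrix function, and let $V:\mathbb{R}^d\to\mathbb{R}$ be a function, such that the linear gradient DAE $A\dot z=S(z)\nabla V(z)$ is regular with configuration space $\mathcal{M}$, and $V$ is proper for this DAE. Then $V$ is a dissipated quantity of this DAE if $A^\dagger S(z)$ is negative semidefinite for every $z\in\mathcal{M}$.
   Context: $A^\dagger$ is the Moore--Penrose inverse of $A$; $A$ may be singular. A (not necessarily symmetric) matrix $X\in\mathbb{R}^{d\times d}$ is negative semidefinite if $\langle x,Xx\rangle\le0$ for all $x\in\mathbb{R}^d$. A DAE $A\dot z=f(z)$ (here with $f(z)=S(z)\nabla V(z)$) is called regular if there are a differentiable submanifold $\mathcal{M}$ of $\mathbb{R}^d$ (the configuration space) and a vector field $v:\mathcal{M}\to T\mathcal{M}$ such that a differentiable map $w:[0,T)\to\mathcal{M}$ is a solution of $\dot w=v(w)$ if and only if $z=j\circ w$ is a solution of the DAE, where $j:\mathcal{M}\to\mathbb{R}^d$ is the inclusion. In particular all solutions lie in $\mathcal{M}$. Let $\mathrm{car}(A)=\mathrm{null}(A)^\perp$. A differentiable function $V$ is proper for the DAE if $\nabla V(z)\in\mathrm{car}(A)$ for every $z\in\mathcal{M}$. A $C^r$ function $V$ ($r\ge1$, $d\ge1$) is a dissipated quantity of the DAE if $\frac{d}{dt}V(z(t))\le0$ for every solution $z$ of the DAE. *)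

theory Defs
  imports "HOL-Analysis.Analysis"
begin

section \<open>Linear algebra\<close>

definition is_moore_penrose_inverse :: "real^'n^'m \<Rightarrow> real^'m^'n \<Rightarrow> bool" where
  "is_moore_penrose_inverse A X \<longleftrightarrow>
     A ** X ** A = A \<and> X ** A ** X = X \<and>
     transpose (A ** X) = A ** X \<and> transpose (X ** A) = X ** A"

text \<open>The four Penrose equations have exactly one solution for every real matrix.\<close>
definition moore_penrose_inverse :: "real^'n^'m \<Rightarrow> real^'m^'n" where
  "moore_penrose_inverse A = (THE X. is_moore_penrose_inverse A X)"

text \<open>The matrix need not be symmetric.\<close>
definition negative_semidefinite :: "real^'n^'n \<Rightarrow> bool" where
  "negative_semidefinite X \<longleftrightarrow> (\<forall>x. x \<bullet> (X *v x) \<le> 0)"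

definition car :: "real^'n^'m \<Rightarrow> (real^'n) set" where
  "car A = orthogonal_comp {x. A *v x = 0}"


section \<open>Differential calculus\<close>

text \<open>Only meaningful for open \<open>U\<close>; \<open>frechet_derivative f (at x) b\<close> is then the partial
  derivative in the direction of the basis vector \<open>b\<close>, so that the recursion says that all
  iterated partial derivatives of order up to \<open>r\<close> exist and are continuous.\<close>
primrec Cr_on :: "nat \<Rightarrow> ('a::euclidean_space \<Rightarrow> 'b::real_normed_vector) \<Rightarrow> 'a set \<Rightarrow> bool" where
  "Cr_on 0 f U \<longleftrightarrow> continuous_on U f"
| "Cr_on (Suc r) f U \<longleftrightarrow>
     f differentiable_on U \<and> (\<forall>b\<in>Basis. Cr_on r (\<lambda>x. frechet_derivative f (at x) b) U)"

definition grad :: "('a::real_inner \<Rightarrow> real) \<Rightarrow> 'a \<Rightarrow> 'a" where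
  "grad V z = (THE g. GDERIV V z :> g)"

definition C1_diffeomorphism ::
  "'a::euclidean_space set \<Rightarrow> 'a set \<Rightarrow> ('a \<Rightarrow> 'a) \<Rightarrow> ('a \<Rightarrow> 'a) \<Rightarrow> bool" where
  "C1_diffeomorphism U W \<phi> \<psi> \<longleftrightarrow>
     open U \<and> open W \<and> homeomorphism U W \<phi> \<psi> \<and> Cr_on 1 \<phi> U \<and> Cr_on 1 \<psi> W"

text \<open>Embedded \<open>k\<close>-dimensional submanifolds of class \<open>C\<^sup>1\<close>, given by slice charts.
  The empty set is a submanifold.\<close>
definition submanifold_dim :: "nat \<Rightarrow> 'a::euclidean_space set \<Rightarrow> bool" where
  "submanifold_dim k M \<longleftrightarrow>
     (\<forall>p\<in>M. \<exists>U W \<phi> \<psi> L. p \<in> U \<and> C1_diffeomorphism U W \<phi> \<psi> \<and>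
        subspace L \<and> dim L = k \<and> \<phi> ` (M \<inter> U) = L \<inter> W)"

definition differentiable_submanifold :: "'a::euclidean_space set \<Rightarrow> bool" where
  "differentiable_submanifold M \<longleftrightarrow> (\<exists>k\<le>DIM('a). submanifold_dim k M)"

text \<open>Velocities at \<open>p\<close> of differentiable curves in \<open>M\<close>, as vectors of the ambient space.\<close>
definition tangent_space :: "'a::euclidean_space set \<Rightarrow> 'a \<Rightarrow> 'a set" where
  "tangent_space M p =
     {u. \<exists>\<epsilon>>0. \<exists>c::real \<Rightarrow> 'a. c ` {-\<epsilon><..<\<epsilon>} \<subseteq> M \<and> c differentiable_on {-\<epsilon><..<\<epsilon>} \<and>
           c 0 = p \<and> (c has_vector_derivative u) (at 0)}"

definition vector_field_on :: "'a::euclidean_space set \<Rightarrow> ('a \<Rightarrow> 'a) \<Rightarrow> bool" where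
  "vector_field_on M v \<longleftrightarrow> (\<forall>p\<in>M. v p \<in> tangent_space M p)"


section \<open>Differential-algebraic equations\<close>

text \<open>The interval \<open>[0,T)\<close>, where \<open>T = \<infinity>\<close> is allowed. Maps on \<open>[0,T)\<close> are represented by total
  functions on the reals whose values outside the interval are irrelevant; derivatives are taken
  within the interval, i.e. they are one-sided at \<open>0\<close>.\<close>
definition time_interval :: "ereal \<Rightarrow> real set" where
  "time_interval T = {t. 0 \<le> t \<and> ereal t < T}"

definition ode_solution :: "('a::real_normed_vector \<Rightarrow> 'a) \<Rightarrow> ereal \<Rightarrow> (real \<Rightarrow> 'a) \<Rightarrow> bool" where
  "ode_solution v T w \<longleftrightarrow>
     (\<forall>t\<in>time_interval T. (w has_vector_derivative v (w t)) (at t within time_interval T))"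

definition dae_solution ::
  "real^'d^'d \<Rightarrow> (real^'d \<Rightarrow> real^'d) \<Rightarrow> ereal \<Rightarrow> (real \<Rightarrow> real^'d) \<Rightarrow> bool" where
  "dae_solution A f T z \<longleftrightarrow>
     (\<forall>t\<in>time_interval T. \<exists>z'. (z has_vector_derivative z') (at t within time_interval T) \<and>
        A *v z' = f (z t))"

text \<open>The inclusion of \<open>M\<close> is left implicit. Since \<open>M\<close> is embedded, a map into \<open>M\<close> is
  differentiable iff it is differentiable as a map into the ambient space. The last
  conjunct says that every solution of the DAE is of the form \<open>j \<circ> w\<close>; the preceding
  equivalence alone only speaks about curves that are already known to lie in \<open>M\<close>.\<close>
definition regular_dae ::
  "real^'d^'d \<Rightarrow> (real^'d \<Rightarrow> real^'d) \<Rightarrow> (real^'d) set \<Rightarrow> bool" where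
  "regular_dae A f M \<longleftrightarrow>
     differentiable_submanifold M \<and>
     (\<exists>v. vector_field_on M v \<and>
        (\<forall>T>0. \<forall>w. w ` time_interval T \<subseteq> M \<and> w differentiable_on time_interval T \<longrightarrow>
           (ode_solution v T w \<longleftrightarrow> dae_solution A f T w))) \<and>
     (\<forall>T>0. \<forall>z. dae_solution A f T z \<longrightarrow> z ` time_interval T \<subseteq> M)"

definition linear_gradient_rhs ::
  "(real^'d \<Rightarrow> real^'d^'d) \<Rightarrow> (real^'d \<Rightarrow> real) \<Rightarrow> real^'d \<Rightarrow> real^'d" where
  "linear_gradient_rhs S V z = S z *v grad V z"

definition proper_for_dae ::
  "real^'d^'d \<Rightarrow> (real^'d) set \<Rightarrow> (real^'d \<Rightarrow> real) \<Rightarrow> bool" where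
  "proper_for_dae A M V \<longleftrightarrow> (\<forall>z. V differentiable (at z)) \<and> (\<forall>z\<in>M. grad V z \<in> car A)"

definition dissipated_quantity ::
  "nat \<Rightarrow> real^'d^'d \<Rightarrow> (real^'d \<Rightarrow> real^'d) \<Rightarrow> (real^'d \<Rightarrow> real) \<Rightarrow> bool" where
  "dissipated_quantity r A f V \<longleftrightarrow>
     Cr_on r V UNIV \<and>
     (\<forall>T>0. \<forall>z. dae_solution A f T z \<longrightarrow>
        (\<forall>t\<in>time_interval T. \<exists>D. ((\<lambda>s. V (z s)) has_real_derivative D) (at t within time_interval T) \<and>
           D \<le> 0))"

end

(* For g = grad V(z) in car A and P = A^+ A, the orthogonal projection onto car A, any velocity z'
   with A z' = S(z) g satisfies
     d/dt V(z) = <g, z'> = <P g, z'> = <g, A^+ A z'> = <g, A^+ S(z) g> \<le> 0. *)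
theory Submission
  imports Defs
begin

text \<open>Since \<open>A ** X\<close> and \<open>A ** Y\<close> are symmetric, transposing their
  product merely swaps the factors. One order collapses to \<open>A ** X\<close> and the other to
  \<open>A ** Y\<close>, so the two agree; likewise \<open>X ** A = Y ** A\<close>. Then X = XAX =
  XAY = YAY = Y.\<close>

lemma moore_penrose_inverse_unique:
  fixes A :: "real^'n^'m"
  assumes "is_moore_penrose_inverse A X" "is_moore_penrose_inverse A Y"
  shows "X = Y"
proof -
  have X: "A ** X ** A = A" "X ** A ** X = X"
      "transpose (A ** X) = A ** X" "transpose (X ** A) = X ** A"
    and Y: "A ** Y ** A = A" "Y ** A ** Y = Y"
      "transpose (A ** Y) = A ** Y" "transpose (Y ** A) = Y ** A"
    using assms by (auto simp: is_moore_penrose_inverse_def)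
  have "A ** X = (A ** Y) ** (A ** X)"
    by (metis Y(1) matrix_mul_assoc)
  also have "\<dots> = transpose ((A ** X) ** (A ** Y))"
    by (simp add: matrix_transpose_mul[of "A ** X" "A ** Y"] X(3) Y(3))
  also have "\<dots> = A ** Y"
    by (metis X(1) Y(3) matrix_mul_assoc)
  finally have AXY: "A ** X = A ** Y" .
  have "X ** A = (X ** A) ** (Y ** A)"
    by (metis Y(1) matrix_mul_assoc)
  also have "\<dots> = transpose ((Y ** A) ** (X ** A))"
    by (simp add: matrix_transpose_mul[of "Y ** A" "X ** A"] X(4) Y(4))
  also have "\<dots> = Y ** A"
    by (metis X(1) Y(4) matrix_mul_assoc)
  finally have "X ** A = Y ** A" .
  then show "X = Y"
    by (metis AXY X(2) Y(2) matrix_mul_assoc)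
qed

text \<open>Expansion in an orthonormal basis of \<open>U\<close> gives \<open>P\<close>. Applied
  below to \<open>car A\<close> and to the range of \<open>A\<close>, the two subspaces from which
  the pseudoinverse is built.\<close>

lemma orthogonal_projection_exists:
  fixes U :: "'a::euclidean_space set"
  assumes "subspace U"
  obtains P where "linear P" "\<And>x. P x \<in> U" "\<And>x. x \<in> U \<Longrightarrow> P x = x"
    "\<And>x y. P x \<bullet> y = x \<bullet> P y" "\<And>x. x - P x \<in> orthogonal_comp U"
proof -
  obtain B where B: "B \<subseteq> U" "pairwise orthogonal B" "\<And>b. b \<in> B \<Longrightarrow> norm b = 1"
      "independent B" "span B = U"
    using orthonormal_basis_subspace[OF assms] by metis
  have fin: "finite B"
    using B(4) independent_imp_finite by blast
  define P where "P x = (\<Sum>b\<in>B. (x \<bullet> b) *\<^sub>R b)" for x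
  have lin: "linear P"
    unfolding P_def
    by (intro linearI) (simp_all add: inner_add_left scaleR_add_left sum.distrib scaleR_sum_right)
  have in_U: "P x \<in> U" for x
    unfolding P_def using B(1) assms by (intro subspace_sum subspace_mul) auto
  have basis: "P b = b" if "b \<in> B" for b
  proof -
    have "P b = (\<Sum>c\<in>B. if c = b then b else 0)"
      unfolding P_def
    proof (rule sum.cong)
      fix c assume "c \<in> B"
      then show "(b \<bullet> c) *\<^sub>R c = (if c = b then b else 0)"
        using B(2,3) that by (auto simp: pairwise_def orthogonal_def norm_eq_1)
    qed simp
    then show ?thesis using fin that by simp
  qed
  have fixed: "P x = x" if "x \<in> U" for x
    using linear_eq_on[OF lin linear_ident, of x B] basis B(5) that by auto
  have sym: "P x \<bullet> y = x \<bullet> P y" for x y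
    unfolding P_def by (simp add: inner_sum_left inner_sum_right inner_commute mult.commute)
  \<comment> \<open>For u in \<open>U\<close>, symmetry moves \<open>P\<close> onto u, which it
    fixes, so x and \<open>P x\<close> have the same inner product with u.\<close>
  have "x - P x \<in> orthogonal_comp U" for x
    by (simp add: orthogonal_comp_def orthogonal_def inner_diff_right)
      (metis sym fixed)
  with that lin in_U fixed sym show thesis by blast
qed

text \<open>The inverse is constructed geometrically: project onto the range of \<open>A\<close>,
  then undo \<open>A\<close> on \<open>car A\<close>, where it is injective. Both products with
  \<open>A\<close> become orthogonal projections, \<open>A ** X\<close> onto the range and
  \<open>X ** A\<close> onto \<open>car A\<close>, which yields the four equations.\<close>

lemma moore_penrose_inverse_exists:
  fixes A :: "real^'n^'m"
  shows "\<exists>X. is_moore_penrose_inverse A X"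
proof -
  let ?N = "{x. A *v x = 0}"
  have subN: "subspace ?N"
    by (rule linear_subspace_kernel) (rule matrix_vector_mul_linear)
  have subC: "subspace (car A)"
    unfolding car_def by (rule subspace_orthogonal_comp)
  obtain P where P: "linear P" "\<And>x. P x \<in> car A" "\<And>x. x \<in> car A \<Longrightarrow> P x = x"
    "\<And>x y. P x \<bullet> y = x \<bullet> P y" "\<And>x. x - P x \<in> orthogonal_comp (car A)"
    using orthogonal_projection_exists[OF subC] by metis
  have "subspace (range ((*v) A))"
    by (intro linear_subspace_image matrix_vector_mul_linear subspace_UNIV)
  from orthogonal_projection_exists[OF this]
  obtain Q where Q: "linear Q" "\<And>y. Q y \<in> range ((*v) A)"
    "\<And>y. y \<in> range ((*v) A) \<Longrightarrow> Q y = y" "\<And>x y. Q x \<bullet> y = x \<bullet> Q y"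
    by metis
  \<comment> \<open>The remainder \<open>x - P x\<close> lies in the double orthogonal complement of
    the kernel, which is the kernel itself.\<close>
  have AP: "A *v P x = A *v x" for x
    using P(5)[of x] orthogonal_comp_self[OF subN]
    by (simp add: car_def matrix_vector_mult_diff_distrib)
  \<comment> \<open>Two points with the same image differ by a vector both in the kernel and
    orthogonal to it, hence by zero.\<close>
  have "inj_on ((*v) A) (car A)"
  proof (rule inj_onI)
    fix x y assume xy: "x \<in> car A" "y \<in> car A" "A *v x = A *v y"
    then have "x - y \<in> car A" "x - y \<in> ?N"
      using subC by (auto simp: subspace_diff matrix_vector_mult_diff_distrib)
    then have "orthogonal (x - y) (x - y)"
      unfolding car_def orthogonal_comp_def by blast
    then show "x = y" by (simp add: orthogonal_self)
  qed
  then obtain G where G: "linear G" "\<And>x. x \<in> car A \<Longrightarrow> G (A *v x) = x"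
    using linear_exists_left_inverse_on[OF matrix_vector_mul_linear subC] by metis
  have GA: "G (A *v x) = P x" for x
    using G(2)[OF P(2)] AP by metis
  \<comment> \<open>\<open>G\<close> inverts \<open>A\<close> on the range only; \<open>Q\<close>
    comes first so that \<open>G\<close> is never applied elsewhere.\<close>
  define X where "X = matrix (G \<circ> Q)"
  have X: "X *v y = G (Q y)" for y
    unfolding X_def using linear_compose[OF Q(1) G(1)] by (simp add: matrix_works)
  have AX: "A *v (X *v y) = Q y" for y
    using Q(2)[of y] by (auto simp: X GA AP)
  have XA: "X *v (A *v x) = P x" for x
    by (simp add: X Q(3) GA)
  have "A ** X ** A = A"
    unfolding matrix_eq by (simp add: XA AP flip: matrix_vector_mul_assoc)
  moreover have "X ** A ** X = X"
    unfolding matrix_eq by (metis AX X Q(2,3) matrix_vector_mul_assoc)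
  moreover have "transpose (A ** X) = A ** X"
  proof -
    \<comment> \<open>Symmetry of the matrix is self-adjointness of the projection \<open>Q\<close>
      that it represents.\<close>
    have "y \<bullet> (transpose (A ** X) *v x) = y \<bullet> ((A ** X) *v x)" for x y
      by (metis AX Q(4) dot_lmul_matrix inner_commute matrix_vector_mul_assoc transpose_matrix_vector)
    then show ?thesis
      by (metis matrix_eq vector_eq_ldot)
  qed
  moreover have "transpose (X ** A) = X ** A"
  proof -
    have "y \<bullet> (transpose (X ** A) *v x) = y \<bullet> ((X ** A) *v x)" for x y
      by (metis XA P(4) dot_lmul_matrix inner_commute matrix_vector_mul_assoc transpose_matrix_vector)
    then show ?thesis
      by (metis matrix_eq vector_eq_ldot)
  qed
  ultimately show ?thesis
    unfolding is_moore_penrose_inverse_def by blast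
qed

lemma is_moore_penrose_inverse_moore_penrose_inverse:
  "is_moore_penrose_inverse A (moore_penrose_inverse A)"
  unfolding moore_penrose_inverse_def
  by (rule theI') (metis moore_penrose_inverse_exists moore_penrose_inverse_unique)

text \<open>By A X A = A, the difference of x and its image under the inverse times \<open>A\<close>
  lies in the kernel of \<open>A\<close>, to which g is orthogonal. This replaces z' by A z' in the
  dissipation estimate.\<close>

lemma inner_moore_penrose_inverse_mult:
  fixes A :: "real^'n^'m"
  assumes "g \<in> car A"
  shows "g \<bullet> (moore_penrose_inverse A *v (A *v x)) = g \<bullet> x"
proof -
  have "A *v (x - moore_penrose_inverse A *v (A *v x)) = 0"
    using is_moore_penrose_inverse_moore_penrose_inverse[of A]
    by (simp add: is_moore_penrose_inverse_def matrix_vector_mult_diff_distrib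
        matrix_vector_mul_assoc matrix_mul_assoc)
  with assms have "(x - moore_penrose_inverse A *v (A *v x)) \<bullet> g = 0"
    by (auto simp: car_def orthogonal_comp_def orthogonal_def)
  then show ?thesis
    by (simp add: inner_diff_left inner_commute[of g])
qed

text \<open>Riesz representation: the derivative is the inner product with
  \<open>adjoint f' 1\<close>, and uniqueness of derivatives makes this vector the value of the
  \<open>THE\<close> in \<open>grad\<close>.\<close>

lemma GDERIV_grad:
  fixes V :: "'a::euclidean_space \<Rightarrow> real"
  assumes "V differentiable (at z)"
  shows "GDERIV V z :> grad V z"
proof -
  obtain f' where f': "(V has_derivative f') (at z)"
    using assms by (auto simp: differentiable_def)
  then have "f' = (\<lambda>h. h \<bullet> adjoint f' 1)"
    using adjoint_works[OF has_derivative_linear[OF f'], of _ 1] by auto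
  with f' have ex: "GDERIV V z :> adjoint f' 1"
    by (simp add: gderiv_def)
  have "g = adjoint f' 1" if "GDERIV V z :> g" for g
    using has_derivative_unique[OF that[unfolded gderiv_def] ex[unfolded gderiv_def]]
    by (metis vector_eq_ldot)
  with ex show ?thesis
    unfolding grad_def by (rule theI)
qed

theorem proposition5p6:
  fixes A :: "real^'d^'d"
    and S :: "real^'d \<Rightarrow> real^'d^'d"
    and V :: "real^'d \<Rightarrow> real"
    and M :: "(real^'d) set"
    and r :: nat
  assumes "1 \<le> r" and "Cr_on r V UNIV"
    and "regular_dae A (linear_gradient_rhs S V) M"
    and "proper_for_dae A M V"
    and "\<And>z. z \<in> M \<Longrightarrow> negative_semidefinite (moore_penrose_inverse A ** S z)"
  shows "dissipated_quantity r A (linear_gradient_rhs S V) V"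
  unfolding dissipated_quantity_def
proof (intro conjI allI impI ballI)
  show "Cr_on r V UNIV" by fact
next
  fix T :: ereal and z :: "real \<Rightarrow> real^'d" and t
  let ?I = "time_interval T" and ?g = "grad V (z t)"
  assume T: "T > 0" and sol: "dae_solution A (linear_gradient_rhs S V) T z" and t: "t \<in> ?I"
  \<comment> \<open>Regularity confines every solution to \<open>M\<close>, so properness and
    semidefiniteness are available at \<open>z t\<close>.\<close>
  have zM: "z t \<in> M"
    using assms(3) T sol t by (auto simp: regular_dae_def)
  obtain z' where z': "(z has_vector_derivative z') (at t within ?I)"
      and eq: "A *v z' = S (z t) *v ?g"
    using sol t by (auto simp: dae_solution_def linear_gradient_rhs_def)
  have V: "GDERIV V (z t) :> ?g" and g: "?g \<in> car A"
    using assms(4) zM by (auto simp: proper_for_dae_def GDERIV_grad)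
  \<comment> \<open>Chain rule with the full derivative of \<open>V\<close> outside and the
    derivative of z within the interval inside, so the one-sided case t = 0 is covered.\<close>
  have "((\<lambda>s. V (z s)) has_derivative (\<lambda>h. (h *\<^sub>R z') \<bullet> ?g)) (at t within ?I)"
    using has_derivative_compose z' V unfolding has_vector_derivative_def gderiv_def by blast
  then have "((\<lambda>s. V (z s)) has_real_derivative ?g \<bullet> z') (at t within ?I)"
    by (simp add: has_field_derivative_def inner_commute mult_commute_abs)
  moreover have "?g \<bullet> z' \<le> 0"
    using assms(5)[OF zM] inner_moore_penrose_inverse_mult[OF g, of z']
    by (simp add: eq negative_semidefinite_def matrix_vector_mul_assoc)
      metis
  ultimately show "\<exists>D. ((\<lambda>s. V (z s)) has_real_derivative D) (at t within ?I) \<and> D \<le> 0"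
    by blast
qed

end
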